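(* For the spectral problem $\Psi_{,1}=U\Psi$ with $U=\begin{pmatrix}0&1\\ u-\lambda&0\end{pmatrix}$ (the spatial part of the matrix Lax pair of the KdV equation), the nilpotent Darboux matrix $$D=\mathcal N\Big(I+\frac{M}{\lambda-\lambda_1}\Big),\qquad D^{-1}=\Big(I-\frac{M}{\lambda-\lambda_1}\Big)\mathcal N^{-1},\qquad M^2=0,$$ generates the classical binary Darboux transformation $$\tilde u=u-2\,\frac{\partial^2}{\partial x^2}\ln\Big|c_0-\int\hat\psi_1^2\Big| .$$
   Context: Here $x=x^1$, $f_{,1}=\partial f/\partial x$, the spectral parameter $\lambda$ and $\lambda_1$ are constants, and $\mathcal N=\mathcal N(x)$ (the nondegenerate normalization matrix) and $M=M(x)$ are $2\times2$ matrices independent of $\lambda$. The problem $\Psi_{,1}=U\Psi$ is the matrix form of the Sturm–Liouville–Schrödinger problem $-\psi_{,11}+u\psi=\lambda\psi$, the columns of $\Psi$ being of the form $(\psi,\psi_{,1})^T$. The function $\hat\psi_1$ is a solution of $-\hat\psi_{1,11}+u\hat\psi_1=\lambda_1\hat\psi_1$, $\int\hat\psi_1^2$ is an antiderivative in $x$, and $c_0$ is a constant of integration; the map $u\mapsto\tilde u$ displayed in the claim is the classical binary Darboux transformation for the Sturm–Liouville–Schrödinger spectral problem. "Generates" means that the gauge-like transformation $\tilde\Psi=D\Psi$, i.e. $\tilde U=D_{,1}D^{-1}+DUD^{-1}$, yields $\tilde U=\begin{pmatrix}0&1\\ \tilde u-\lambda&0\end{pmatrix}$ with this $\tilde u$.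 The data of $D$ are $$M=g\begin{pmatrix}-\sigma&1\\-\sigma^2&\sigma\end{pmatrix},\quad \mathcal N=\begin{pmatrix}1&0\\ \gamma&1\end{pmatrix},\quad g=-\gamma,\quad \sigma=\frac{\hat\psi_{1,1}}{\hat\psi_1},\quad \gamma=\frac{\hat\psi_1^2}{c_0-\int\hat\psi_1^2},$$ and $\tilde u=u+2\gamma_{,1}$. (For complex-valued $\hat\psi_1$ or $c_0$ the formula for $\tilde u$ is to be read as $\tilde u=u+2\gamma_{,1}$.) *)

theory Defs
  imports "HOL-Analysis.Analysis"
begin

text \<open>The independent variable \<open>x = x\<^sup>1\<close> is real and ranges over an open set \<open>S\<close>;
  all fields are complex valued, so real-valued data are included. Functions of \<open>x\<close> are total
  in HOL, and only their values on \<open>S\<close> matter.\<close>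

text \<open>\<open>f\<^sub>,\<^sub>1 = \<partial>f/\<partial>x\<close>. The value is meaningful only where \<open>f\<close> is differentiable, which is
  therefore stated separately wherever it is needed.\<close>

definition ddx :: "(real \<Rightarrow> 'a::real_normed_vector) \<Rightarrow> real \<Rightarrow> 'a" where
  "ddx f x = vector_derivative f (at x)"

definition mat22 :: "'a::zero \<Rightarrow> 'a \<Rightarrow> 'a \<Rightarrow> 'a \<Rightarrow> 'a^2^2" where
  "mat22 a b c d = vector [vector [a, b], vector [c, d]]"

definition schrodinger_solution ::
  "real set \<Rightarrow> (real \<Rightarrow> complex) \<Rightarrow> complex \<Rightarrow> (real \<Rightarrow> complex) \<Rightarrow> bool" where
  "schrodinger_solution S u lam psi \<longleftrightarrow>
     (\<forall>x\<in>S. psi differentiable (at x) \<and> ddx psi differentiable (at x) \<and>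
            - ddx (ddx psi) x + u x * psi x = lam * psi x)"

definition lax_U :: "(real \<Rightarrow> complex) \<Rightarrow> complex \<Rightarrow> real \<Rightarrow> complex^2^2" where
  "lax_U u lam x = mat22 0 1 (u x - lam) 0"

definition matrix_solution ::
  "real set \<Rightarrow> (real \<Rightarrow> complex^2^2) \<Rightarrow> (real \<Rightarrow> complex^2^2) \<Rightarrow> bool" where
  "matrix_solution S U Psi \<longleftrightarrow>
     (\<forall>x\<in>S. Psi differentiable (at x) \<and> ddx Psi x = U x ** Psi x)"

text \<open>The gauge-like transformation \<open>\<Psi> \<mapsto> D \<Psi>\<close> takes the linear problem with matrix \<open>U\<close>
  to the one with matrix \<open>V\<close>.\<close>

definition gauge_transforms ::
  "real set \<Rightarrow> (real \<Rightarrow> complex^2^2) \<Rightarrow> (real \<Rightarrow> complex^2^2) \<Rightarrow> (real \<Rightarrow> complex^2^2) \<Rightarrow> bool" where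
  "gauge_transforms S D U V \<longleftrightarrow>
     (\<forall>x\<in>S. D differentiable (at x) \<and> invertible (D x) \<and>
            V x = ddx D x ** matrix_inv (D x) + D x ** U x ** matrix_inv (D x)) \<and>
     (\<forall>Psi. matrix_solution S U Psi \<longrightarrow> matrix_solution S V (\<lambda>x. D x ** Psi x))"

text \<open>Data of the Darboux matrix. The argument \<open>Q\<close> is the chosen antiderivative
  \<open>\<integral>\<psi>\<^sup>2\<close>, for \<open>\<psi>\<close> the seed solution at the spectral value \<open>\<lambda>\<^sub>1\<close>.\<close>

definition dt_sigma :: "(real \<Rightarrow> complex) \<Rightarrow> real \<Rightarrow> complex" where
  "dt_sigma psi x = ddx psi x / psi x"

definition dt_gamma ::
  "(real \<Rightarrow> complex) \<Rightarrow> (real \<Rightarrow> complex) \<Rightarrow> complex \<Rightarrow> real \<Rightarrow> complex" where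
  "dt_gamma psi Q c0 x = (psi x)\<^sup>2 / (c0 - Q x)"

definition dt_N ::
  "(real \<Rightarrow> complex) \<Rightarrow> (real \<Rightarrow> complex) \<Rightarrow> complex \<Rightarrow> real \<Rightarrow> complex^2^2" where
  "dt_N psi Q c0 x = mat22 1 0 (dt_gamma psi Q c0 x) 1"

definition dt_M ::
  "(real \<Rightarrow> complex) \<Rightarrow> (real \<Rightarrow> complex) \<Rightarrow> complex \<Rightarrow> real \<Rightarrow> complex^2^2" where
  "dt_M psi Q c0 x =
     (let g = - dt_gamma psi Q c0 x; s = dt_sigma psi x
      in map_matrix (\<lambda>z. g * z) (mat22 (- s) 1 (- s\<^sup>2) s))"

definition dt_D ::
  "(real \<Rightarrow> complex) \<Rightarrow> (real \<Rightarrow> complex) \<Rightarrow> complex \<Rightarrow> complex \<Rightarrow> complex \<Rightarrow> real \<Rightarrow> complex^2^2" where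
  "dt_D psi Q c0 lam1 lam x =
     dt_N psi Q c0 x ** (mat 1 + map_matrix (\<lambda>z. z / (lam - lam1)) (dt_M psi Q c0 x))"

end

theory Submission
  imports Defs
begin

text \<open>The Schroedinger equation for the seed turns into the Riccati equation
  \<open>\<sigma>' = u - \<lambda>\<^sub>1 - \<sigma>\<^sup>2\<close>, and the quotient rule gives \<open>\<gamma>' = 2 \<sigma> \<gamma> + \<gamma>\<^sup>2\<close>. With these, the
  intertwining relation \<open>D' + D U = V D\<close> is a polynomial identity in \<open>\<gamma>, \<sigma>, u, \<lambda>, \<lambda>\<^sub>1\<close> and
  \<open>k = 1 / (\<lambda> - \<lambda>\<^sub>1)\<close>, modulo \<open>k (\<lambda> - \<lambda>\<^sub>1) = 1\<close>. In the real case
  \<open>(ln |c\<^sub>0 - Q|)' = - \<gamma>\<close>.\<close>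

section \<open>Entrywise arithmetic of 2x2 matrices\<close>

lemma mat22_nth [simp]:
  "mat22 a b c d $ 1 $ 1 = a" "mat22 a b c d $ 1 $ 2 = b"
  "mat22 a b c d $ 2 $ 1 = c" "mat22 a b c d $ 2 $ 2 = d"
  by (simp_all add: mat22_def)

lemma mat22_eq_iff:
  "mat22 a b c d = mat22 a' b' c' d' \<longleftrightarrow> a = a' \<and> b = b' \<and> c = c' \<and> d = d'"
  by (auto simp: vec_eq_iff forall_2)

lemma mat22_mult:
  fixes a :: "'a::semiring_1"
  shows "mat22 a b c d ** mat22 a' b' c' d' =
    mat22 (a * a' + b * c') (a * b' + b * d') (c * a' + d * c') (c * b' + d * d')"
  by (simp add: vec_eq_iff forall_2 matrix_matrix_mult_def sum_2)

lemma mat22_add: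
  fixes a :: "'a::monoid_add"
  shows "mat22 a b c d + mat22 a' b' c' d' = mat22 (a + a') (b + b') (c + c') (d + d')"
  by (simp add: vec_eq_iff forall_2)

lemma mat22_diff:
  fixes a :: "'a::group_add"
  shows "mat22 a b c d - mat22 a' b' c' d' = mat22 (a - a') (b - b') (c - c') (d - d')"
  by (simp add: vec_eq_iff forall_2)

lemma map_matrix_mat22: "map_matrix f (mat22 a b c d) = mat22 (f a) (f b) (f c) (f d)"
  by (simp add: vec_eq_iff forall_2 map_matrix_def)

lemma mat_eq_mat22: "mat k = mat22 k 0 0 k"
  by (simp add: vec_eq_iff forall_2 mat_def)

lemma zero_eq_mat22: "0 = mat22 0 0 0 0"
  by (simp add: vec_eq_iff forall_2)

text \<open>Rewriting with this set turns an equation between matrix expressions into a conjunction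
  of four scalar equations.\<close>

lemmas mat22_simps = mat22_mult mat22_add mat22_diff map_matrix_mat22 mat_eq_mat22
  zero_eq_mat22 mat22_eq_iff

section \<open>Differentiation of matrix-valued functions\<close>

text \<open>The four entries are packed into a tuple so that the derivative rule for bounded linear
  maps differentiates a matrix entry by entry. Boundedness is automatic in finite dimension.\<close>

lemma bounded_linear_mat22:
  "bounded_linear (\<lambda>(a, b, c, d). mat22 a b c d :: complex^2^2)"
  unfolding linear_conv_bounded_linear[symmetric]
  by (rule linearI) (auto simp: vec_eq_iff forall_2)

lemma has_vector_derivative_mat22:
  fixes a b c d :: "real \<Rightarrow> complex"
  assumes "(a has_vector_derivative a') (at x within T)" "(b has_vector_derivative b') (at x within T)"
    "(c has_vector_derivative c') (at x within T)" "(d has_vector_derivative d') (at x within T)"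
  shows "((\<lambda>y. mat22 (a y) (b y) (c y) (d y)) has_vector_derivative mat22 a' b' c' d')
    (at x within T)"
  using bounded_linear.has_vector_derivative[OF bounded_linear_mat22
      has_vector_derivative_Pair[OF assms(1) has_vector_derivative_Pair[OF assms(2)
      has_vector_derivative_Pair[OF assms(3,4)]]]]
  by simp

text \<open>Source of the noncommutative product rule for \<open>D ** Psi\<close> and of left
  distributivity.\<close>

lemma bounded_bilinear_matrix_mult:
  "bounded_bilinear (\<lambda>(A :: complex^'n^'m) (B :: complex^'k^'n). A ** B)"
  unfolding bilinear_conv_bounded_bilinear[symmetric] bilinear_def
  by (auto intro!: linearI simp: vec_eq_iff matrix_matrix_mult_def sum.distrib
      algebra_simps scaleR_sum_right)

section \<open>Inverses and gauge transformations\<close>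

text \<open>For square matrices a one-sided inverse is two-sided, so one product suffices. As
  \<open>matrix_inv\<close> is a Hilbert choice, its value is then pinned down by
  uniqueness.\<close>

lemma matrix_inv_unique_right:
  fixes A B :: "complex^'n^'n"
  assumes "A ** B = mat 1"
  shows "invertible A" "matrix_inv A = B"
proof -
  have *: "B ** A = mat 1"
    using assms by (simp add: matrix_left_right_inverse)
  with assms show "invertible A"
    by (auto simp: invertible_def)
  have "C = B" if "A ** C = mat 1 \<and> C ** A = mat 1" for C
    using * that by (metis matrix_mul_assoc matrix_mul_lid matrix_mul_rid)
  with * assms show "matrix_inv A = B"
    unfolding matrix_inv_def by (intro some_equality conjI) blast+
qed

text \<open>The intertwining relation contains no inverse. Multiplying it on the right by the
  inverse of \<open>D x\<close> gives the formula for \<open>V\<close>; applying it to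
  \<open>Psi\<close> gives (D Psi)' = (D' + D U) Psi = V D Psi.\<close>

lemma gauge_transformsI:
  fixes D U V :: "real \<Rightarrow> complex^2^2"
  assumes D: "\<And>x. x \<in> S \<Longrightarrow> (D has_vector_derivative D' x) (at x)"
    and inv: "\<And>x. x \<in> S \<Longrightarrow> invertible (D x)"
    and eq: "\<And>x. x \<in> S \<Longrightarrow> D' x + D x ** U x = V x ** D x"
  shows "gauge_transforms S D U V"
  unfolding gauge_transforms_def
proof (intro conjI ballI allI impI)
  fix x assume x: "x \<in> S"
  obtain B where B: "D x ** B = mat 1"
    using inv[OF x] by (auto simp: invertible_def)
  have ddx: "ddx D x = D' x"
    using D[OF x] by (simp add: ddx_def vector_derivative_at)
  show "D differentiable at x"
    using D[OF x] by (rule differentiableI_vector)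
  show "invertible (D x)"
    using x by (rule inv)
  have "ddx D x ** matrix_inv (D x) + D x ** U x ** matrix_inv (D x)
      = V x ** (D x ** matrix_inv (D x))"
    by (simp add: ddx eq[OF x] matrix_mul_assoc flip: bounded_bilinear.add_left[OF bounded_bilinear_matrix_mult])
  then show "V x = ddx D x ** matrix_inv (D x) + D x ** U x ** matrix_inv (D x)"
    by (simp add: matrix_inv_unique_right(2)[OF B] B)
next
  fix Psi assume Psi: "matrix_solution S U Psi"
  have "((\<lambda>x. D x ** Psi x) has_vector_derivative V x ** (D x ** Psi x)) (at x)"
    if x: "x \<in> S" for x
  proof -
    have "(Psi has_vector_derivative U x ** Psi x) (at x)"
      using Psi x by (metis matrix_solution_def ddx_def vector_derivative_works)
    from bounded_bilinear.has_vector_derivative[OF bounded_bilinear_matrix_mult D[OF x] this]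
    have "((\<lambda>x. D x ** Psi x) has_vector_derivative
        (D x ** U x + D' x) ** Psi x) (at x)"
      by (simp add: bounded_bilinear.add_left[OF bounded_bilinear_matrix_mult] matrix_mul_assoc)
    then show ?thesis
      by (simp add: eq[OF x] matrix_mul_assoc add.commute)
  qed
  then show "matrix_solution S V (\<lambda>x. D x ** Psi x)"
    unfolding matrix_solution_def ddx_def
    by (auto intro: differentiableI_vector vector_derivative_at)
qed

text \<open>Lets the logarithmic form of the new potential replace the one with \<gamma>, as the two
  are compared only on \<open>S\<close>.\<close>

lemma gauge_transforms_cong:
  assumes "\<And>x. x \<in> S \<Longrightarrow> V x = W x"
  shows "gauge_transforms S D U V \<longleftrightarrow> gauge_transforms S D U W"
  using assms by (simp add: gauge_transforms_def matrix_solution_def)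

section \<open>Derivatives of \<sigma> and \<gamma>\<close>

lemma has_vector_derivative_quotient:
  fixes f g :: "real \<Rightarrow> complex"
  assumes "(f has_vector_derivative f') (at x within T)"
    and "(g has_vector_derivative g') (at x within T)" "g x \<noteq> 0"
  shows "((\<lambda>y. f y / g y) has_vector_derivative (f' * g x - f x * g') / (g x)\<^sup>2) (at x within T)"
  unfolding has_vector_derivative_def
  by (rule has_derivative_eq_rhs[OF has_derivative_divide'[OF assms[unfolded has_vector_derivative_def]]])
    (simp add: fun_eq_iff scaleR_conv_of_real power2_eq_square right_diff_distrib mult_ac)

lemma has_vector_derivative_dt_sigma:
  assumes "schrodinger_solution S u lam psi" "x \<in> S" "psi x \<noteq> 0"
  shows "(dt_sigma psi has_vector_derivative u x - lam - (dt_sigma psi x)\<^sup>2) (at x)"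
proof -
  have psi: "(psi has_vector_derivative ddx psi x) (at x)"
    and dpsi: "(ddx psi has_vector_derivative ddx (ddx psi) x) (at x)"
    using assms(1,2) unfolding schrodinger_solution_def ddx_def
    by (auto simp: vector_derivative_works)
  have eq: "ddx (ddx psi) x = (u x - lam) * psi x"
    using assms(1,2) unfolding schrodinger_solution_def
    by (auto simp: algebra_simps)
  show ?thesis
    using has_vector_derivative_quotient[OF dpsi psi assms(3)] assms(3)
    by (simp add: dt_sigma_def[abs_def] eq diff_divide_distrib power2_eq_square)
qed

lemma has_vector_derivative_dt_gamma:
  assumes "(psi has_vector_derivative ddx psi x) (at x)"
    and "(Q has_vector_derivative (psi x)\<^sup>2) (at x)" "psi x \<noteq> 0" "c0 - Q x \<noteq> 0"
  shows "(dt_gamma psi Q c0 has_vector_derivative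
    2 * dt_sigma psi x * dt_gamma psi Q c0 x + (dt_gamma psi Q c0 x)\<^sup>2) (at x)"
proof -
  have "((\<lambda>y. (psi y)\<^sup>2) has_vector_derivative 2 * psi x * ddx psi x) (at x)"
    using has_vector_derivative_mult[OF assms(1,1)]
    by (simp add: power2_eq_square mult.assoc)
  moreover have "((\<lambda>y. c0 - Q y) has_vector_derivative - (psi x)\<^sup>2) (at x)"
    using has_vector_derivative_diff[OF has_vector_derivative_const assms(2)] by simp
  ultimately have "((\<lambda>y. (psi y)\<^sup>2 / (c0 - Q y)) has_vector_derivative
      (2 * psi x * ddx psi x * (c0 - Q x) - (psi x)\<^sup>2 * - (psi x)\<^sup>2) / (c0 - Q x)\<^sup>2) (at x)"
    using assms(4) by (rule has_vector_derivative_quotient)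
  \<comment> \<open>Since psi' = \<sigma> psi, the first summand of the quotient rule is 2 \<sigma>
    \<gamma>; the second, psi^4 / (c0 - Q)^2, is \<gamma>^2.\<close>
  moreover have "(2 * psi x * ddx psi x * (c0 - Q x) - (psi x)\<^sup>2 * - (psi x)\<^sup>2) / (c0 - Q x)\<^sup>2
      = 2 * dt_sigma psi x * dt_gamma psi Q c0 x + (dt_gamma psi Q c0 x)\<^sup>2"
    using assms(3,4) unfolding dt_sigma_def dt_gamma_def
    by (simp add: divide_simps) (simp add: algebra_simps power2_eq_square)
  ultimately show ?thesis
    by (simp add: dt_gamma_def[abs_def])
qed

section \<open>Nilpotency and invertibility of the Darboux data\<close>

text \<open>Here \<open>g\<close> is \<gamma> itself, the negative of the \<open>g\<close> bound in
  \<open>dt_M\<close>, hence the changed signs.\<close>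

lemma dt_M_eq_mat22:
  "dt_M psi Q c0 x = (let g = dt_gamma psi Q c0 x; s = dt_sigma psi x
     in mat22 (g * s) (- g) (g * s\<^sup>2) (- (g * s)))"
  by (simp add: dt_M_def Let_def map_matrix_mat22)

text \<open>M is a multiple of the column (1, \<sigma>) times the row (-\<sigma>, 1), and that row
  annihilates that column.\<close>

lemma dt_M_square: "dt_M psi Q c0 x ** dt_M psi Q c0 x = 0"
  by (simp add: dt_M_eq_mat22 Let_def mat22_simps power2_eq_square)

lemma invertible_dt_N: "invertible (dt_N psi Q c0 x)"
proof (rule matrix_inv_unique_right(1))
  show "dt_N psi Q c0 x ** mat22 1 0 (- dt_gamma psi Q c0 x) 1 = mat 1"
    by (simp add: dt_N_def mat22_simps)
qed

text \<open>With P = M / (lam - lam1), nilpotency gives (1 + P)(1 - P) = 1 - P^2 = 1, so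
  \<open>(mat 1 - ?P) ** ?Ni\<close> is a right inverse of D = N (1 + P).\<close>

lemma
  shows invertible_dt_D: "invertible (dt_D psi Q c0 lam1 lam x)"
    and matrix_inv_dt_D: "matrix_inv (dt_D psi Q c0 lam1 lam x) =
      (mat 1 - map_matrix (\<lambda>z. z / (lam - lam1)) (dt_M psi Q c0 x))
        ** matrix_inv (dt_N psi Q c0 x)"
proof -
  let ?P = "map_matrix (\<lambda>z. z / (lam - lam1)) (dt_M psi Q c0 x)"
  let ?Ni = "mat22 1 0 (- dt_gamma psi Q c0 x) 1"
  have N: "dt_N psi Q c0 x ** ?Ni = mat 1"
    by (simp add: dt_N_def mat22_simps)
  have P: "(mat 1 + ?P) ** (mat 1 - ?P) = mat 1"
    by (simp add: dt_M_eq_mat22 Let_def mat22_simps divide_inverse) (intro conjI; algebra)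
  have "dt_D psi Q c0 lam1 lam x ** ((mat 1 - ?P) ** ?Ni)
      = dt_N psi Q c0 x ** ((mat 1 + ?P) ** (mat 1 - ?P)) ** ?Ni"
    by (simp add: dt_D_def matrix_mul_assoc)
  also have "\<dots> = mat 1"
    by (simp add: P N)
  finally have D: "dt_D psi Q c0 lam1 lam x ** ((mat 1 - ?P) ** ?Ni) = mat 1" .
  show "invertible (dt_D psi Q c0 lam1 lam x)"
    using D by (rule matrix_inv_unique_right)
  show "matrix_inv (dt_D psi Q c0 lam1 lam x) = (mat 1 - ?P) ** matrix_inv (dt_N psi Q c0 x)"
    by (simp only: matrix_inv_unique_right(2)[OF D] matrix_inv_unique_right(2)[OF N])
qed

section \<open>The intertwining relation for the Darboux matrix\<close>

text \<open>Naming the reciprocal \<open>k\<close> makes every entry a polynomial in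
  \<open>g\<close>, \<open>s\<close> and \<open>k\<close>, ready for differentiation and for
  polynomial algebra.\<close>

lemma dt_D_eq_mat22:
  "dt_D psi Q c0 lam1 lam x =
    (let g = dt_gamma psi Q c0 x; s = dt_sigma psi x; k = inverse (lam - lam1)
     in mat22 (1 + k * (g * s)) (- (k * g))
          (g + k * (g\<^sup>2 * s) + k * (g * s\<^sup>2)) (1 - k * g\<^sup>2 - k * (g * s)))"
  by (simp add: dt_D_def dt_N_def dt_M_eq_mat22 Let_def mat22_simps)
    (simp add: field_simps power2_eq_square)

lemma gauge_transforms_dt_D:
  assumes "schrodinger_solution S u lam1 psi"
    and "\<forall>x\<in>S. psi x \<noteq> 0"
    and "\<forall>x\<in>S. (Q has_vector_derivative (psi x)\<^sup>2) (at x)"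
    and "\<forall>x\<in>S. c0 - Q x \<noteq> 0"
    and "lam \<noteq> lam1"
  shows "gauge_transforms S (dt_D psi Q c0 lam1 lam) (lax_U u lam)
    (lax_U (\<lambda>x. u x + 2 * ddx (dt_gamma psi Q c0) x) lam)"
proof -
  define g s k where "g = dt_gamma psi Q c0" and "s = dt_sigma psi" and "k = inverse (lam - lam1)"
  define g' s' where "g' = (\<lambda>x. 2 * s x * g x + (g x)\<^sup>2)" and "s' = (\<lambda>x. u x - lam1 - (s x)\<^sup>2)"
  \<comment> \<open>This is all that the algebra below needs to know about \<open>k\<close>; it is
    the only place where \<open>lam \<noteq> lam1\<close> enters.\<close>
  have k: "k * lam = 1 + k * lam1"
    using assms(5) by (simp add: k_def field_simps)
  show ?thesis
  proof (rule gauge_transformsI)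
    fix x assume x: "x \<in> S"
    have "(psi has_vector_derivative ddx psi x) (at x)"
      using assms(1) x unfolding schrodinger_solution_def ddx_def
      by (auto simp: vector_derivative_works)
    then have g: "(g has_vector_derivative g' x) (at x)"
      unfolding g_def g'_def s_def using assms(2-4) x
      by (intro has_vector_derivative_dt_gamma) auto
    have s: "(s has_vector_derivative s' x) (at x)"
      unfolding s_def s'_def using assms(1,2) x by (intro has_vector_derivative_dt_sigma) auto
    \<comment> \<open>Entrywise product rule applied to \<open>dt_D_eq_mat22\<close>, with \<gamma>'
      and \<sigma>' kept as \<open>g'\<close> and \<open>s'\<close>.\<close>
    let ?D' = "mat22 (k * (g x * s' x + g' x * s x)) (- (k * g' x))
          (g' x + k * ((g x)\<^sup>2 * s' x + 2 * g x * g' x * s x)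
            + k * (2 * g x * s x * s' x + g' x * (s x)\<^sup>2))
          (- (k * (2 * g x * g' x)) - k * (g x * s' x + g' x * s x))"
    show "(dt_D psi Q c0 lam1 lam has_vector_derivative ?D') (at x)"
      \<comment> \<open>Squares become products so that the product rule differentiates
        them.\<close>
      unfolding dt_D_eq_mat22[abs_def] Let_def g_def[symmetric] s_def[symmetric] k_def[symmetric]
        power2_eq_square
      by (rule has_vector_derivative_mat22)
        (rule derivative_eq_intros g s refl | simp add: algebra_simps)+
    show "invertible (dt_D psi Q c0 lam1 lam x)"
      by (rule invertible_dt_D)
    have dg: "ddx g x = g' x"
      using g by (simp add: ddx_def vector_derivative_at)
    show "?D' + dt_D psi Q c0 lam1 lam x ** lax_U u lam x
        = lax_U (\<lambda>x. u x + 2 * ddx (dt_gamma psi Q c0) x) lam x ** dt_D psi Q c0 lam1 lam x"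
      unfolding g_def[symmetric] dt_D_eq_mat22 Let_def s_def[symmetric] k_def[symmetric] lax_U_def
      \<comment> \<open>The upper right equation is free of \<open>lam\<close> and follows from
        \<open>g'\<close> alone; the other three use \<open>k\<close>. The new potential occurs only
        in the lower row, where the shift \<open>2 * g'\<close> is what makes the equations
        hold.\<close>
      by (simp add: mat22_mult mat22_add mat22_eq_iff dg g'_def s'_def)
        (intro conjI; (use k in algebra | simp add: algebra_simps power2_eq_square))
  qed
qed

section \<open>The logarithmic form for real data\<close>

text \<open>The imaginary part vanishes on a neighbourhood of \<open>x\<close>, so its derivative is
  0. Used for Q, to see that its derivative psi^2 is real, and then for \<gamma>.\<close>

lemma has_vector_derivative_Reals:
  fixes f :: "real \<Rightarrow> complex"
  assumes "(f has_vector_derivative f') (at x)" "open S" "x \<in> S" "\<forall>y\<in>S. f y \<in> \<real>"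
  shows "f' \<in> \<real>"
proof -
  have "((\<lambda>y. Im (f y)) has_vector_derivative Im f') (at x)"
    using bounded_linear_Im assms(1) by (rule bounded_linear.has_vector_derivative)
  then have "((\<lambda>y. 0) has_vector_derivative Im f') (at x)"
    using assms(2,3) by (rule has_vector_derivative_transform_within_open)
      (use assms(4) in \<open>auto simp: complex_is_Real_iff\<close>)
  then have "Im f' = 0"
    by (rule vector_derivative_unique_at) (rule has_vector_derivative_const)
  then show ?thesis
    by (simp add: complex_is_Real_iff)
qed

text \<open>On \<open>S\<close> the function c0 - Q is a real function R, and ln |R| = ln (R^2) / 2
  can be differentiated without splitting on the sign of R.\<close>

lemma has_vector_derivative_ln_cmod:
  assumes "(Q has_vector_derivative Q') (at x)" "c0 - Q x \<noteq> 0"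
    and "open S" "x \<in> S" "c0 \<in> \<real>" "\<forall>x\<in>S. Q x \<in> \<real>"
  shows "((\<lambda>y. ln (cmod (c0 - Q y))) has_vector_derivative - Re (Q' / (c0 - Q x))) (at x)"
proof -
  define R where "R = (\<lambda>y. Re (c0 - Q y))"
  have re: "c0 - Q y = of_real (R y)" if "y \<in> S" for y
    using that assms(5,6) by (simp add: R_def complex_eq_iff complex_is_Real_iff)
  have R0: "R x \<noteq> 0"
    using re[OF assms(4)] assms(2) by (metis of_real_0)
  have "((\<lambda>y. c0 - Q y) has_vector_derivative - Q') (at x)"
    using has_vector_derivative_diff[OF has_vector_derivative_const assms(1)] by simp
  then have "(R has_real_derivative - Re Q') (at x)"
    unfolding R_def using has_field_derivative_Re by fastforce
  then have "((\<lambda>y. ln ((R y)\<^sup>2) / 2) has_real_derivative - Re Q' / R x) (at x)"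
    using R0 by (auto intro!: derivative_eq_intros simp: power2_eq_square zero_less_mult_iff)
  moreover have "Re (Q' / (c0 - Q x)) = Re Q' / R x"
    by (subst re[OF assms(4)]) (simp only: Re_divide_of_real)
  ultimately have "((\<lambda>y. ln ((R y)\<^sup>2) / 2) has_vector_derivative - Re (Q' / (c0 - Q x))) (at x)"
    by (simp add: has_real_derivative_iff_has_vector_derivative)
  then show ?thesis
    using assms(3,4)
  proof (rule has_vector_derivative_transform_within_open)
    fix y assume "y \<in> S"
    then have "cmod (c0 - Q y) = \<bar>R y\<bar>"
      by (metis re norm_of_real)
    \<comment> \<open>Nonvanishing is known only at \<open>x\<close>; where \<open>R y = 0\<close>
      both sides are 0 by the convention \<open>ln 0 = 0\<close>.\<close>
    moreover have "ln ((R y)\<^sup>2) = 2 * ln \<bar>R y\<bar>"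
      using ln_realpow[of "\<bar>R y\<bar>" 2] by (cases "R y = 0") simp_all
    ultimately show "ln ((R y)\<^sup>2) / 2 = ln (cmod (c0 - Q y))"
      by simp
  qed
qed

section \<open>Assembly, with the passage from \<gamma> to the logarithm\<close>

theorem corollary4p6:
  fixes S :: "real set" and u psi1 Q :: "real \<Rightarrow> complex" and lam1 c0 :: complex
  assumes "open S"
    and "schrodinger_solution S u lam1 psi1"
    and "\<forall>x\<in>S. psi1 x \<noteq> 0"
    and "\<forall>x\<in>S. (Q has_vector_derivative (psi1 x)\<^sup>2) (at x)"
    and "\<forall>x\<in>S. c0 - Q x \<noteq> 0"
  shows "(\<forall>x\<in>S. dt_M psi1 Q c0 x ** dt_M psi1 Q c0 x = 0 \<and> invertible (dt_N psi1 Q c0 x))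
    \<and> (\<forall>lam. lam \<noteq> lam1 \<longrightarrow> (\<forall>x\<in>S.
          invertible (dt_D psi1 Q c0 lam1 lam x) \<and>
          matrix_inv (dt_D psi1 Q c0 lam1 lam x) =
            (mat 1 - map_matrix (\<lambda>z. z / (lam - lam1)) (dt_M psi1 Q c0 x))
              ** matrix_inv (dt_N psi1 Q c0 x)))
    \<and> (\<forall>x\<in>S. dt_gamma psi1 Q c0 differentiable (at x))
    \<and> (\<forall>lam. lam \<noteq> lam1 \<longrightarrow>
          gauge_transforms S (dt_D psi1 Q c0 lam1 lam) (lax_U u lam)
            (lax_U (\<lambda>x. u x + 2 * ddx (dt_gamma psi1 Q c0) x) lam))
    \<and> (c0 \<in> \<real> \<and> (\<forall>x\<in>S. Q x \<in> \<real>) \<longrightarrow>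
          (\<forall>x\<in>S. (\<lambda>y. ln (cmod (c0 - Q y))) differentiable (at x) \<and>
                 ddx (\<lambda>y. ln (cmod (c0 - Q y))) differentiable (at x)) \<and>
          (\<forall>lam. lam \<noteq> lam1 \<longrightarrow>
             gauge_transforms S (dt_D psi1 Q c0 lam1 lam) (lax_U u lam)
               (lax_U (\<lambda>x. u x - 2 * complex_of_real (ddx (ddx (\<lambda>y. ln (cmod (c0 - Q y)))) x)) lam)))"
proof -
  note sol = assms(2) and nz = assms(3) and dQ = assms(4) and cQ = assms(5)
  let ?g = "dt_gamma psi1 Q c0" and ?l = "\<lambda>y. ln (cmod (c0 - Q y))"
  have gauge: "gauge_transforms S (dt_D psi1 Q c0 lam1 lam) (lax_U u lam)
      (lax_U (\<lambda>x. u x + 2 * ddx ?g x) lam)" if "lam \<noteq> lam1" for lam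
    using sol nz dQ cQ that by (rule gauge_transforms_dt_D)
  have g: "(?g has_vector_derivative ddx ?g x) (at x)" if x: "x \<in> S" for x
  proof -
    have "(psi1 has_vector_derivative ddx psi1 x) (at x)"
      using sol x unfolding schrodinger_solution_def ddx_def
      by (auto simp: vector_derivative_works)
    from has_vector_derivative_dt_gamma[OF this] nz dQ cQ x show ?thesis
      by (metis ddx_def vector_derivative_at)
  qed
  have real: "(\<forall>x\<in>S. ?l differentiable (at x) \<and> ddx ?l differentiable (at x)) \<and>
      (\<forall>x\<in>S. complex_of_real (ddx (ddx ?l) x) = - ddx ?g x)"
    if c0: "c0 \<in> \<real>" and Q: "\<forall>x\<in>S. Q x \<in> \<real>"
  proof -
    have l: "(?l has_vector_derivative - Re (?g x)) (at x)" if "x \<in> S" for x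
      unfolding dt_gamma_def using dQ cQ that c0 Q assms(1)
      by (intro has_vector_derivative_ln_cmod[of _ _ _ _ S]) auto
    then have ddl: "ddx ?l x = - Re (?g x)" if "x \<in> S" for x
      using that by (simp add: ddx_def vector_derivative_at)
    have l2: "(ddx ?l has_vector_derivative - Re (ddx ?g x)) (at x)" if x: "x \<in> S" for x
    proof -
      have "((\<lambda>y. - Re (?g y)) has_vector_derivative - Re (ddx ?g x)) (at x)"
        using has_vector_derivative_minus[OF
            bounded_linear.has_vector_derivative[OF bounded_linear_Re g[OF x]]]
        by simp
      \<comment> \<open>\<open>ddl\<close> identifies the first derivative only on \<open>S\<close>;
        as \<open>S\<close> is open, this is enough to differentiate once more at
        \<open>x\<close>.\<close>
      then show ?thesis
        using assms(1) x by (rule has_vector_derivative_transform_within_open) (simp add: ddl)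
    qed
    \<comment> \<open>Only c0 and Q are assumed real. The seed may be complex, for instance purely
      imaginary, but its square is the derivative of Q and hence real.\<close>
    have "?g x \<in> \<real>" if x: "x \<in> S" for x
    proof -
      have "(psi1 x)\<^sup>2 \<in> \<real>"
        using dQ x by (intro has_vector_derivative_Reals[OF _ assms(1) x Q]) auto
      then show ?thesis
        using c0 Q x by (simp add: dt_gamma_def)
    qed
    then have "ddx ?g x \<in> \<real>" if "x \<in> S" for x
      using that by (intro has_vector_derivative_Reals[OF g assms(1)]) auto
    then have "complex_of_real (ddx (ddx ?l) x) = - ddx ?g x" if "x \<in> S" for x
      using that vector_derivative_at[OF l2] by (simp add: complex_eq_iff complex_is_Real_iff ddx_def)
    then show ?thesis
      using l l2 by (blast intro: differentiableI_vector)
  qed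
  have gauge_real: "gauge_transforms S (dt_D psi1 Q c0 lam1 lam) (lax_U u lam)
      (lax_U (\<lambda>x. u x - 2 * complex_of_real (ddx (ddx ?l) x)) lam)"
    if "c0 \<in> \<real>" "\<forall>x\<in>S. Q x \<in> \<real>" "lam \<noteq> lam1" for lam
  proof -
    have "gauge_transforms S (dt_D psi1 Q c0 lam1 lam) (lax_U u lam)
        (lax_U (\<lambda>x. u x - 2 * complex_of_real (ddx (ddx ?l) x)) lam) \<longleftrightarrow>
      gauge_transforms S (dt_D psi1 Q c0 lam1 lam) (lax_U u lam)
        (lax_U (\<lambda>x. u x + 2 * ddx ?g x) lam)"
      by (rule gauge_transforms_cong) (use real[OF that(1,2)] in \<open>simp add: lax_U_def\<close>)
    with gauge[OF that(3)] show ?thesis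
      by simp
  qed
  show ?thesis
    by (intro conjI allI ballI impI)
      (simp_all add: dt_M_square invertible_dt_N invertible_dt_D matrix_inv_dt_D gauge gauge_real
        real differentiableI_vector[OF g])
qed

end
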